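(* Let $K\in\mathcal{M}_n(\mathbb{R})$ be a DPP kernel with only real eigenvalues $\lambda_1,\dots,\lambda_n\in[0,1]$ (written with multiplicities). If $X\sim\mathrm{DPP}(K)$, then $|X|$ has the same distribution as $B_1+\cdots+B_n$, where $B_1,\dots,B_n$ are independent Bernoulli random variables and $B_i$ has parameter $\lambda_i$.
   Context: $[n]=\{1,\dots,n\}$; $\mathcal{M}_n(\mathbb{R})$ is the set of real $n\times n$ matrices; $|X|$ is the cardinality of $X$. For $S\subset[n]$, $K_S$ is the principal submatrix of $K$ with rows and columns indexed by $S$, with $\det(K_\emptyset)=1$. The determinantal measure with kernel $K$ is the unique signed measure $\mu$ on the power set $\mathcal{P}([n])$ such that $\mu(\{X\in\mathcal{P}([n]): S\subset X\})=\det(K_S)$ for all $S\subset[n]$. $K$ is called a DPP kernel if this $\mu$ is a probability measure; then $X\sim\mathrm{DPP}(K)$ means that $X$ is a random subset of $[n]$ with law $\mu$, i.e. $\mathbb{P}(S\subset X)=\det(K_S)$ for all $S\subset[n]$. Kernels are not assumed symmetric. *)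

theory Defs
  imports
    "HOL-Probability.Probability"
    "Jordan_Normal_Form.Char_Poly"
    "Jordan_Normal_Form.DL_Submatrix"
begin

text \<open>
  The ground set \<open>[n]\<close> is represented as \<open>{..<n}\<close>, since matrices are indexed from \<open>0\<close>.
  The name \<open>det\<close> also exists in \<open>HOL-Analysis\<close>, so the determinant
  is written \<open>Determinant.det\<close>.
\<close>

definition principal_submatrix :: "real mat \<Rightarrow> nat set \<Rightarrow> real mat" where
  "principal_submatrix K S = submatrix K S S"

lemma det_principal_submatrix_empty: "Determinant.det (principal_submatrix K {}) = 1"
  unfolding principal_submatrix_def
  by (rule det_dim_zero) (auto simp: submatrix_def)

text \<open>
  A finite signed measure on the \<open>\<sigma>\<close>-algebra of all subsets of a finite set \<open>\<Omega>\<close>. As \<open>\<Omega>\<close> is finite,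
  countable additivity amounts to additivity; membership in \<open>extensional\<close>
  only fixes the irrelevant values outside \<open>Pow \<Omega>\<close>, so that equality of signed measures is
  equality of functions.
\<close>

definition finite_signed_measure :: "'a set \<Rightarrow> ('a set \<Rightarrow> real) \<Rightarrow> bool" where
  "finite_signed_measure \<Omega> \<mu> \<longleftrightarrow>
     \<mu> \<in> extensional (Pow \<Omega>) \<and> \<mu> {} = 0 \<and>
     (\<forall>A B. A \<subseteq> \<Omega> \<longrightarrow> B \<subseteq> \<Omega> \<longrightarrow> A \<inter> B = {} \<longrightarrow> \<mu> (A \<union> B) = \<mu> A + \<mu> B)"

definition is_determinantal_measure :: "nat \<Rightarrow> real mat \<Rightarrow> (nat set set \<Rightarrow> real) \<Rightarrow> bool" where
  "is_determinantal_measure n K \<mu> \<longleftrightarrow>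
     finite_signed_measure (Pow {..<n}) \<mu> \<and>
     (\<forall>S\<subseteq>{..<n}. \<mu> {X \<in> Pow {..<n}. S \<subseteq> X} = Determinant.det (principal_submatrix K S))"

definition determinantal_measure :: "nat \<Rightarrow> real mat \<Rightarrow> nat set set \<Rightarrow> real" where
  "determinantal_measure n K = (THE \<mu>. is_determinantal_measure n K \<mu>)"

lemma finite_signed_measure_sum:
  assumes "finite_signed_measure \<Omega> \<mu>" "finite A" "A \<subseteq> \<Omega>"
  shows "\<mu> A = (\<Sum>X\<in>A. \<mu> {X})"
  using assms(2,3)
proof (induction A rule: finite_induct)
  case empty
  then show ?case using assms(1) by (simp add: finite_signed_measure_def)
next
  case (insert x A)
  have add: "\<And>A B. A \<subseteq> \<Omega> \<Longrightarrow> B \<subseteq> \<Omega> \<Longrightarrow> A \<inter> B = {} \<Longrightarrow> \<mu> (A \<union> B) = \<mu> A + \<mu> B"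
    using assms(1) by (simp add: finite_signed_measure_def)
  have "\<mu> ({x} \<union> A) = \<mu> {x} + \<mu> A"
    using insert.hyps insert.prems by (intro add) auto
  with insert show ?case by simp
qed

lemma superset_sums_exist:
  fixes h :: "'a set \<Rightarrow> real"
  assumes "finite U"
  shows "\<exists>m. \<forall>S\<subseteq>U. (\<Sum>X\<in>{X \<in> Pow U. S \<subseteq> X}. m X) = h S"
  using assms
proof (induction U arbitrary: h rule: finite_induct)
  case empty
  have "{X \<in> Pow {}. {} \<subseteq> X} = {{} :: 'a set}"
    by auto
  then show ?case by (intro exI[of _ h]) simp
next
  case (insert x U)
  obtain m1 where m1: "\<And>S. S \<subseteq> U \<Longrightarrow> (\<Sum>X\<in>{X \<in> Pow U. S \<subseteq> X}. m1 X) = h (insert x S)"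
    using insert.IH[of "\<lambda>S. h (insert x S)"] by blast
  obtain m0 where m0: "\<And>S. S \<subseteq> U \<Longrightarrow> (\<Sum>X\<in>{X \<in> Pow U. S \<subseteq> X}. m0 X) = h S - h (insert x S)"
    using insert.IH[of "\<lambda>S. h S - h (insert x S)"] by blast
  define m where "m X = (if x \<in> X then m1 (X - {x}) else m0 X)" for X
  have inj: "inj_on (insert x) {X \<in> Pow U. S \<subseteq> X}" for S
  proof (rule inj_onI)
    fix A B assume "A \<in> {X \<in> Pow U. S \<subseteq> X}" "B \<in> {X \<in> Pow U. S \<subseteq> X}"
      and eq: "insert x A = insert x B"
    then have "x \<notin> A" "x \<notin> B" using insert.hyps(2) by auto
    with eq show "A = B" by (simp add: insert_ident)
  qed
  have upper: "(\<Sum>X\<in>insert x ` {X \<in> Pow U. S \<subseteq> X}. m X) = h (insert x S)" if "S \<subseteq> U" for S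
  proof -
    have "(\<Sum>X\<in>insert x ` {X \<in> Pow U. S \<subseteq> X}. m X) = (\<Sum>X\<in>{X \<in> Pow U. S \<subseteq> X}. m (insert x X))"
      by (subst sum.reindex[OF inj]) (simp only: o_def)
    also have "\<dots> = (\<Sum>X\<in>{X \<in> Pow U. S \<subseteq> X}. m1 X)"
    proof (rule sum.cong[OF refl])
      fix X assume "X \<in> {X \<in> Pow U. S \<subseteq> X}"
      then have "x \<notin> X" using insert.hyps(2) by auto
      then show "m (insert x X) = m1 X" by (simp add: m_def)
    qed
    finally show ?thesis using m1[OF that] by simp
  qed
  have "(\<Sum>X\<in>{X \<in> Pow (insert x U). S \<subseteq> X}. m X) = h S" if S: "S \<subseteq> insert x U" for S
  proof (cases "x \<in> S")
    case True
    have "{X \<in> Pow (insert x U). S \<subseteq> X} = insert x ` {X \<in> Pow U. S - {x} \<subseteq> X}"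
    proof (intro equalityI subsetI)
      fix X assume "X \<in> {X \<in> Pow (insert x U). S \<subseteq> X}"
      then have "X = insert x (X - {x})" "X - {x} \<in> {X \<in> Pow U. S - {x} \<subseteq> X}"
        using True by auto
      then show "X \<in> insert x ` {X \<in> Pow U. S - {x} \<subseteq> X}" by blast
    qed (use True in auto)
    moreover have "S - {x} \<subseteq> U" "insert x (S - {x}) = S" using S True by auto
    ultimately show ?thesis using upper[of "S - {x}"] by simp
  next
    case False
    then have SU: "S \<subseteq> U" using S by auto
    have "{X \<in> Pow (insert x U). S \<subseteq> X} =
        {X \<in> Pow U. S \<subseteq> X} \<union> insert x ` {X \<in> Pow U. S \<subseteq> X}"
    proof (intro equalityI subsetI)
      fix X assume X: "X \<in> {X \<in> Pow (insert x U). S \<subseteq> X}"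
      show "X \<in> {X \<in> Pow U. S \<subseteq> X} \<union> insert x ` {X \<in> Pow U. S \<subseteq> X}"
      proof (cases "x \<in> X")
        case True
        then have "X = insert x (X - {x})" "X - {x} \<in> {X \<in> Pow U. S \<subseteq> X}"
          using X False by auto
        then show ?thesis by blast
      qed (use X in auto)
    qed auto
    moreover have "{X \<in> Pow U. S \<subseteq> X} \<inter> insert x ` {X \<in> Pow U. S \<subseteq> X} = {}"
      using insert.hyps(2) by auto
    moreover have "(\<Sum>X\<in>{X \<in> Pow U. S \<subseteq> X}. m X) = (\<Sum>X\<in>{X \<in> Pow U. S \<subseteq> X}. m0 X)"
      using insert.hyps(2) by (intro sum.cong refl) (auto simp: m_def)
    moreover have "finite {X \<in> Pow U. S \<subseteq> X}" using insert.hyps(1) by simp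
    ultimately show ?thesis
      using upper[OF SU] m0[OF SU] by (simp only: sum.union_disjoint finite_imageI)
  qed
  then show ?case by blast
qed

lemma superset_sums_unique:
  fixes m m' :: "'a set \<Rightarrow> real"
  assumes U: "finite U"
    and eq: "\<And>S. S \<subseteq> U \<Longrightarrow>
      (\<Sum>X\<in>{X \<in> Pow U. S \<subseteq> X}. m X) = (\<Sum>X\<in>{X \<in> Pow U. S \<subseteq> X}. m' X)"
    and "S \<subseteq> U"
  shows "m S = m' S"
  using assms(3)
proof (induction "card (U - S)" arbitrary: S rule: less_induct)
  case less
  let ?T = "{X \<in> Pow U. S \<subset> X}"
  have split: "{X \<in> Pow U. S \<subseteq> X} = insert S ?T" using less.prems by auto
  have fin: "finite ?T" using U by simp
  have "m X = m' X" if X: "X \<in> ?T" for X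
  proof (rule less.hyps)
    show "card (U - X) < card (U - S)"
      using X U by (intro psubset_card_mono) auto
  qed (use X in auto)
  then have "(\<Sum>X\<in>?T. m X) = (\<Sum>X\<in>?T. m' X)" by (intro sum.cong) auto
  moreover have "sum m (insert S ?T) = sum m' (insert S ?T)"
    using eq[OF less.prems] by (simp only: split)
  moreover have "S \<notin> ?T" by simp
  ultimately show ?case
    using sum.insert[OF fin, of S m] sum.insert[OF fin, of S m'] by linarith
qed

lemma ex1_is_determinantal_measure: "\<exists>!\<mu>. is_determinantal_measure n K \<mu>"
proof (rule ex_ex1I)
  let ?P = "Pow {..<n}"
  obtain m where m: "\<And>S. S \<subseteq> {..<n} \<Longrightarrow>
      (\<Sum>X\<in>{X \<in> ?P. S \<subseteq> X}. m X) = Determinant.det (principal_submatrix K S)"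
    using superset_sums_exist[of "{..<n}" "\<lambda>S. Determinant.det (principal_submatrix K S)"] by auto
  define \<mu> where "\<mu> = restrict (\<lambda>A. \<Sum>X\<in>A. m X) (Pow ?P)"
  have "finite_signed_measure ?P \<mu>"
    unfolding finite_signed_measure_def
  proof (intro conjI allI impI)
    fix A B assume AB: "A \<subseteq> ?P" "B \<subseteq> ?P" "A \<inter> B = {}"
    then have "finite A" "finite B" by (auto intro: finite_subset)
    with AB show "\<mu> (A \<union> B) = \<mu> A + \<mu> B" by (simp add: \<mu>_def sum.union_disjoint)
  qed (auto simp: \<mu>_def)
  moreover have "\<mu> {X \<in> ?P. S \<subseteq> X} = Determinant.det (principal_submatrix K S)"
    if "S \<subseteq> {..<n}" for S
  proof -
    have "{X \<in> ?P. S \<subseteq> X} \<in> Pow ?P" by blast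
    then show ?thesis using m[OF that] by (simp only: \<mu>_def restrict_apply')
  qed
  ultimately show "\<exists>\<mu>. is_determinantal_measure n K \<mu>"
    unfolding is_determinantal_measure_def by blast
next
  let ?P = "Pow {..<n}"
  fix \<mu> \<nu> assume \<mu>: "is_determinantal_measure n K \<mu>" and \<nu>: "is_determinantal_measure n K \<nu>"
  then have sm: "finite_signed_measure ?P \<mu>" "finite_signed_measure ?P \<nu>"
    by (auto simp: is_determinantal_measure_def)
  have fin: "finite A" if "A \<subseteq> ?P" for A
    using that by (rule finite_subset) simp
  have atoms: "\<mu> {X} = \<nu> {X}" if X: "X \<subseteq> {..<n}" for X
  proof (rule superset_sums_unique[where U = "{..<n}" and m = "\<lambda>X. \<mu> {X}" and m' = "\<lambda>X. \<nu> {X}", OF _ _ X])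
    fix S :: "nat set" assume S: "S \<subseteq> {..<n}"
    have sub: "{X \<in> ?P. S \<subseteq> X} \<subseteq> ?P" by blast
    have "\<mu> {X \<in> ?P. S \<subseteq> X} = \<nu> {X \<in> ?P. S \<subseteq> X}"
      using \<mu> \<nu> S by (simp only: is_determinantal_measure_def)
    then show "(\<Sum>X\<in>{X \<in> ?P. S \<subseteq> X}. \<mu> {X}) = (\<Sum>X\<in>{X \<in> ?P. S \<subseteq> X}. \<nu> {X})"
      using finite_signed_measure_sum[OF sm(1) fin[OF sub] sub]
        finite_signed_measure_sum[OF sm(2) fin[OF sub] sub] by simp
  qed simp
  show "\<mu> = \<nu>"
  proof (rule extensionalityI)
    show "\<mu> \<in> extensional (Pow ?P)" "\<nu> \<in> extensional (Pow ?P)"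
      using sm by (auto simp: finite_signed_measure_def)
    fix A assume "A \<in> Pow ?P"
    then have A: "A \<subseteq> ?P" by simp
    have "(\<Sum>X\<in>A. \<mu> {X}) = (\<Sum>X\<in>A. \<nu> {X})"
      using A atoms by (intro sum.cong) auto
    then show "\<mu> A = \<nu> A"
      using finite_signed_measure_sum[OF sm(1) fin[OF A] A]
        finite_signed_measure_sum[OF sm(2) fin[OF A] A] by simp
  qed
qed

lemma is_determinantal_measure_determinantal_measure:
  "is_determinantal_measure n K (determinantal_measure n K)"
  unfolding determinantal_measure_def by (rule theI'[OF ex1_is_determinantal_measure])

definition dpp_kernel :: "nat \<Rightarrow> real mat \<Rightarrow> bool" where
  "dpp_kernel n K \<longleftrightarrow>
     K \<in> carrier_mat n n \<and>
     (\<exists>P. prob_space P \<and> space P = Pow {..<n} \<and> sets P = Pow (Pow {..<n}) \<and>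
        (\<forall>A\<subseteq>Pow {..<n}. measure P A = determinantal_measure n K A))"

definition dpp_distributed :: "'a measure \<Rightarrow> ('a \<Rightarrow> nat set) \<Rightarrow> nat \<Rightarrow> real mat \<Rightarrow> bool" where
  "dpp_distributed M X n K \<longleftrightarrow>
     X \<in> M \<rightarrow>\<^sub>M count_space (Pow {..<n}) \<and>
     (\<forall>A\<subseteq>Pow {..<n}.
        measure (distr M (count_space (Pow {..<n})) X) A = determinantal_measure n K A)"

lemma dpp_distributed_inclusion_prob:
  assumes "dpp_distributed M X n K" "S \<subseteq> {..<n}"
  shows "measure M {\<omega> \<in> space M. S \<subseteq> X \<omega>} = Determinant.det (principal_submatrix K S)"
proof -
  let ?P = "Pow {..<n}" and ?A = "{X \<in> Pow {..<n}. S \<subseteq> X}"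
  have X: "X \<in> M \<rightarrow>\<^sub>M count_space ?P"
    and law: "\<And>A. A \<subseteq> ?P \<Longrightarrow> measure (distr M (count_space ?P) X) A = determinantal_measure n K A"
    using assms(1) by (auto simp: dpp_distributed_def)
  have sub: "?A \<subseteq> ?P" by blast
  have "X -` ?A \<inter> space M = {\<omega> \<in> space M. S \<subseteq> X \<omega>}"
    using measurable_space[OF X] by auto
  then have "measure M {\<omega> \<in> space M. S \<subseteq> X \<omega>} = measure (distr M (count_space ?P) X) ?A"
    using sub by (subst measure_distr[OF X]) auto
  also have "\<dots> = determinantal_measure n K ?A" by (rule law[OF sub])
  also have "\<dots> = Determinant.det (principal_submatrix K S)"
    using is_determinantal_measure_determinantal_measure[of n K] assms(2)
    by (simp only: is_determinantal_measure_def)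
  finally show ?thesis .
qed

text \<open>
  Eigenvalues listed with algebraic multiplicity; for a real matrix the splitting of the
  characteristic polynomial over the reals says that all complex eigenvalues are real.
\<close>

definition real_eigenvalues_with_mult :: "nat \<Rightarrow> real mat \<Rightarrow> (nat \<Rightarrow> real) \<Rightarrow> bool" where
  "real_eigenvalues_with_mult n K lam \<longleftrightarrow> char_poly K = (\<Prod>i<n. [:- lam i, 1:])"

definition bernoulli_distributed :: "'a measure \<Rightarrow> ('a \<Rightarrow> nat) \<Rightarrow> real \<Rightarrow> bool" where
  "bernoulli_distributed M B p \<longleftrightarrow>
     B \<in> M \<rightarrow>\<^sub>M count_space UNIV \<and>
     distr M (count_space UNIV) B = measure_pmf (map_pmf of_bool (bernoulli_pmf p))"

end

theory Submission
  imports Defs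
begin

text \<open>
  Both \<open>card X\<close> and \<open>\<Sum>i<n. B i\<close> lie in \<open>{0..n}\<close> almost surely, so their generating functions are
  polynomials with the point probabilities as coefficients, and it is enough to compare these
  generating functions (\<open>distr_eqI_pgf\<close>). Evaluated at \<open>1 + t\<close>, they are two expressions for
  \<open>det (1 + t K)\<close>.

  Indeed, \<open>(1 + t) ^ card X\<close> is the sum of \<open>t ^ card S\<close> over all \<open>S \<subseteq> X\<close>. Taking expectations
  replaces the condition \<open>S \<subseteq> X\<close> by its probability, which is a principal minor of \<open>K\<close>
  (\<open>expectation_power_card_dpp\<close>), and the sum of \<open>t ^ card S\<close> times the principal minor of \<open>S\<close> is
  the expansion of \<open>det (1 + t K)\<close> (\<open>det_one_plus_smult_eq_sum_minors\<close>). On the other hand, this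
  determinant is the product of the \<open>1 + t * lam i\<close>, because it is the characteristic polynomial of
  \<open>K\<close> at \<open>- 1 / t\<close> up to scaling (\<open>det_one_plus_smult_eq_prod_eigenvalues\<close>). The factor
  \<open>1 + t * lam i\<close> is the generating function at \<open>1 + t\<close> of a Bernoulli variable with parameter
  \<open>lam i\<close>, and independence makes the product the generating function of the sum
  (\<open>expectation_power_sum_bernoulli\<close>).
\<close>

section \<open>Principal minors and the determinant of a perturbed identity\<close>

lemma bij_betw_pick:
  assumes "finite S"
  shows "bij_betw (pick S) {0..<card S} S"
proof -
  have inj: "inj_on (pick S) {0..<card S}"
  proof (rule linorder_inj_onI)
    fix a b assume "a < b" "b \<in> {0..<card S}"
    then show "pick S a \<noteq> pick S b"
      using pick_mono_le[of b S a] by simp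
  qed auto
  moreover have "pick S ` {0..<card S} = S"
  proof (rule card_subset_eq[OF assms])
    show "pick S ` {0..<card S} \<subseteq> S"
      using pick_in_set_le by auto
    show "card (pick S ` {0..<card S}) = card S"
      using card_image[OF inj] by simp
  qed
  ultimately show ?thesis
    by (simp add: bij_betw_def)
qed

lemma bij_betw_map_permutation:
  assumes "bij_betw f A B"
  shows "bij_betw (map_permutation A f) {p. p permutes A} {q. q permutes B}"
proof (rule bij_betw_byWitness[where f' = "map_permutation B (inv_into A f)"])
  have inv: "bij_betw (inv_into A f) B A"
    by (rule bij_betw_inv_into[OF assms])
  show "\<forall>p\<in>{p. p permutes A}. map_permutation B (inv_into A f) (map_permutation A f p) = p"
    using map_permutation_compose_inv[OF assms] bij_betw_inv_into_left[OF assms] by blast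
  show "\<forall>q\<in>{q. q permutes B}. map_permutation A f (map_permutation B (inv_into A f) q) = q"
    using map_permutation_compose_inv[OF inv] bij_betw_inv_into_right[OF assms] by blast
  show "map_permutation A f ` {p. p permutes A} \<subseteq> {q. q permutes B}"
    using map_permutation_permutes[OF assms] by blast
  show "map_permutation B (inv_into A f) ` {q. q permutes B} \<subseteq> {p. p permutes A}"
    using map_permutation_permutes[OF inv] by blast
qed

text \<open>
  Conjugation with the increasing enumeration \<open>pick S\<close> preserves the sign of a permutation, so the
  Leibniz formula can be read over the permutations of \<open>S\<close> itself. This puts all principal minors
  on the same footing, as sums over permutations of the full index set that fix what lies outside \<open>S\<close>.
\<close>

lemma det_principal_minor_permutes:
  fixes K :: "'a :: comm_ring_1 mat"
  assumes K: "K \<in> carrier_mat n n" and S: "S \<subseteq> {..<n}"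
  shows "Determinant.det (submatrix K S S) =
    (\<Sum>p | p permutes S. signof p * (\<Prod>i\<in>S. K $$ (i, p i)))"
proof -
  let ?I = "{0..<card S}"
  have fin: "finite S"
    using S by (rule finite_subset) simp
  note bij = bij_betw_pick[OF fin]
  have inj: "inj_on (pick S) ?I"
    using bij by (rule bij_betw_imp_inj_on)
  have rows: "{i. i < n \<and> i \<in> S} = S"
    using S by auto
  have sub: "submatrix K S S = mat (card S) (card S) (\<lambda>(i, j). K $$ (pick S i, pick S j))"
    using K by (simp add: submatrix_def rows)
  have "(\<Sum>p | p permutes S. signof p * (\<Prod>i\<in>S. K $$ (i, p i))) =
      (\<Sum>q | q permutes ?I. signof (map_permutation ?I (pick S) q) *
         (\<Prod>i\<in>S. K $$ (i, map_permutation ?I (pick S) q i)))"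
    by (rule sum.reindex_bij_betw[symmetric, OF bij_betw_map_permutation[OF bij]])
  also have "\<dots> = (\<Sum>q | q permutes ?I. signof q *
         (\<Prod>i\<in>?I. submatrix K S S $$ (i, q i)))"
  proof (rule sum.cong[OF refl])
    fix q assume "q \<in> {q. q permutes ?I}"
    then have q: "q permutes ?I" by simp
    have "(\<Prod>i\<in>S. K $$ (i, map_permutation ?I (pick S) q i)) =
        (\<Prod>i\<in>?I. K $$ (pick S i, map_permutation ?I (pick S) q (pick S i)))"
      by (rule prod.reindex_bij_betw[symmetric, OF bij])
    also have "\<dots> = (\<Prod>i\<in>?I. submatrix K S S $$ (i, q i))"
    proof (rule prod.cong[OF refl])
      fix i assume i: "i \<in> ?I"
      then have "q i \<in> ?I"
        using permutes_in_image[OF q] by blast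
      with i show "K $$ (pick S i, map_permutation ?I (pick S) q (pick S i)) =
          submatrix K S S $$ (i, q i)"
        by (simp add: map_permutation_apply[OF inj i] sub)
    qed
    finally show "signof (map_permutation ?I (pick S) q) *
          (\<Prod>i\<in>S. K $$ (i, map_permutation ?I (pick S) q i)) =
        signof q * (\<Prod>i\<in>?I. submatrix K S S $$ (i, q i))"
      using sign_map_permutation[OF inj q] by simp
  qed
  also have "\<dots> = Determinant.det (submatrix K S S)"
    by (rule det_def'[symmetric]) (simp add: sub)
  finally show ?thesis by simp
qed

text \<open>
  In the Leibniz expansion, each row contributes either its identity entry or its entry of \<open>t K\<close>.
  Sort the terms by the set \<open>S\<close> of rows of the second kind: the identity entries of the other rows
  kill every permutation that moves a point outside \<open>S\<close>, and what is left is a principal minor.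
\<close>

lemma det_one_plus_smult_eq_sum_minors:
  fixes K :: "'a :: comm_ring_1 mat"
  assumes K: "K \<in> carrier_mat n n"
  shows "Determinant.det (1\<^sub>m n + t \<cdot>\<^sub>m K) =
    (\<Sum>S\<in>Pow {..<n}. t ^ card S * Determinant.det (submatrix K S S))"
proof -
  let ?U = "{..<n}"
  have U: "{0..<n} = ?U" by auto
  have "Determinant.det (1\<^sub>m n + t \<cdot>\<^sub>m K) =
      (\<Sum>p | p permutes ?U. signof p * (\<Prod>i\<in>?U. (1\<^sub>m n + t \<cdot>\<^sub>m K) $$ (i, p i)))"
    unfolding U[symmetric] by (rule det_def') (use K in simp)
  also have "\<dots> = (\<Sum>p | p permutes ?U. signof p *
      (\<Prod>i\<in>?U. t * K $$ (i, p i) + of_bool (p i = i)))"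
  proof (rule sum.cong[OF refl])
    fix p assume "p \<in> {p. p permutes ?U}"
    then have "p i < n" if "i < n" for i
      using that permutes_in_image[of p ?U i] by simp
    then have "(\<Prod>i\<in>?U. (1\<^sub>m n + t \<cdot>\<^sub>m K) $$ (i, p i)) =
        (\<Prod>i\<in>?U. t * K $$ (i, p i) + of_bool (p i = i))"
      using K by (intro prod.cong) auto
    then show "signof p * (\<Prod>i\<in>?U. (1\<^sub>m n + t \<cdot>\<^sub>m K) $$ (i, p i)) =
        signof p * (\<Prod>i\<in>?U. t * K $$ (i, p i) + of_bool (p i = i))"
      by simp
  qed
  also have "\<dots> = (\<Sum>p | p permutes ?U. \<Sum>S\<in>Pow ?U. signof p *
      ((\<Prod>i\<in>S. t * K $$ (i, p i)) * (\<Prod>i\<in>?U - S. of_bool (p i = i))))"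
    by (simp add: prod_add sum_distrib_left)
  also have "\<dots> = (\<Sum>S\<in>Pow ?U. \<Sum>p | p permutes ?U. signof p *
      ((\<Prod>i\<in>S. t * K $$ (i, p i)) * (\<Prod>i\<in>?U - S. of_bool (p i = i))))"
    by (rule sum.swap)
  also have "\<dots> = (\<Sum>S\<in>Pow ?U. t ^ card S * Determinant.det (submatrix K S S))"
  proof (rule sum.cong[OF refl])
    fix S assume "S \<in> Pow ?U"
    then have S: "S \<subseteq> ?U" by simp
    have "(\<Sum>p | p permutes ?U. signof p *
          ((\<Prod>i\<in>S. t * K $$ (i, p i)) * (\<Prod>i\<in>?U - S. of_bool (p i = i)))) =
        (\<Sum>p | p permutes S. signof p *
          ((\<Prod>i\<in>S. t * K $$ (i, p i)) * (\<Prod>i\<in>?U - S. of_bool (p i = i))))"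
    proof (rule sum.mono_neutral_right)
      show "finite {p. p permutes ?U}"
        by (simp add: finite_permutations)
      show "{p. p permutes S} \<subseteq> {p. p permutes ?U}"
        using permutes_subset[OF _ S] by blast
      show "\<forall>p\<in>{p. p permutes ?U} - {p. p permutes S}. signof p *
          ((\<Prod>i\<in>S. t * K $$ (i, p i)) * (\<Prod>i\<in>?U - S. of_bool (p i = i))) = 0"
      proof
        fix p assume p: "p \<in> {p. p permutes ?U} - {p. p permutes S}"
        then obtain i where i: "i \<in> ?U - S" "p i \<noteq> i"
          using permutes_superset[of p ?U S] by blast
        then have "(\<Prod>i\<in>?U - S. of_bool (p i = i)) = (0 :: 'a)"
          by (intro prod_zero) auto
        then show "signof p *
          ((\<Prod>i\<in>S. t * K $$ (i, p i)) * (\<Prod>i\<in>?U - S. of_bool (p i = i))) = 0"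
          by simp
      qed
    qed
    also have "\<dots> = (\<Sum>p | p permutes S. t ^ card S * (signof p * (\<Prod>i\<in>S. K $$ (i, p i))))"
    proof (rule sum.cong[OF refl])
      fix p assume "p \<in> {p. p permutes S}"
      then have "(\<Prod>i\<in>?U - S. of_bool (p i = i)) = (1 :: 'a)"
        by (intro prod.neutral) (auto simp: permutes_not_in)
      then show "signof p *
          ((\<Prod>i\<in>S. t * K $$ (i, p i)) * (\<Prod>i\<in>?U - S. of_bool (p i = i))) =
        t ^ card S * (signof p * (\<Prod>i\<in>S. K $$ (i, p i)))"
        by (simp add: prod.distrib algebra_simps)
    qed
    also have "\<dots> = t ^ card S * Determinant.det (submatrix K S S)"
      by (simp add: det_principal_minor_permutes[OF K S] sum_distrib_left)
    finally show "(\<Sum>p | p permutes ?U. signof p *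
          ((\<Prod>i\<in>S. t * K $$ (i, p i)) * (\<Prod>i\<in>?U - S. of_bool (p i = i)))) =
        t ^ card S * Determinant.det (submatrix K S S)" .
  qed
  finally show ?thesis .
qed

lemma poly_char_poly_eq_det:
  fixes K :: "'a :: comm_ring_1 mat"
  assumes K: "K \<in> carrier_mat n n"
  shows "poly (char_poly K) x = Determinant.det (x \<cdot>\<^sub>m 1\<^sub>m n - K)"
  unfolding char_poly_def
  by (rule poly_det_cong[where n = n]) (use K in \<open>auto simp: char_poly_matrix_def\<close>)

lemma det_one_plus_smult_eq_prod_eigenvalues:
  fixes K :: "'a :: field mat"
  assumes K: "K \<in> carrier_mat n n" and char: "char_poly K = (\<Prod>i<n. [:- lam i, 1:])"
  shows "Determinant.det (1\<^sub>m n + t \<cdot>\<^sub>m K) = (\<Prod>i<n. 1 + t * lam i)"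
proof (cases "t = 0")
  case True
  have "1\<^sub>m n + 0 \<cdot>\<^sub>m K = 1\<^sub>m n"
    using K by auto
  with True show ?thesis by simp
next
  case False
  \<comment> \<open>Pulling out \<open>- t\<close> leaves the matrix whose determinant is the characteristic polynomial at
    \<open>- 1 / t\<close>.\<close>
  have "1\<^sub>m n + t \<cdot>\<^sub>m K = (- t) \<cdot>\<^sub>m ((- 1 / t) \<cdot>\<^sub>m 1\<^sub>m n - K)"
    using K False by (intro eq_matI) (auto simp: field_simps)
  then have "Determinant.det (1\<^sub>m n + t \<cdot>\<^sub>m K) = (- t) ^ n * poly (char_poly K) (- 1 / t)"
    using K by (simp add: poly_char_poly_eq_det[OF K])
  also have "\<dots> = (- t) ^ n * (\<Prod>i<n. - lam i - 1 / t)"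
    unfolding char by (simp add: poly_prod)
  also have "\<dots> = (\<Prod>i<n. (- t) * (- lam i - 1 / t))"
    unfolding prod.distrib by simp
  also have "\<dots> = (\<Prod>i<n. 1 + t * lam i)"
    using False by (intro prod.cong) (auto simp: field_simps)
  finally show ?thesis .
qed


section \<open>Generating functions\<close>

lemma (in prob_space) pgf_bounded_nat:
  fixes A :: "'a \<Rightarrow> nat" and z :: real
  assumes [measurable]: "A \<in> M \<rightarrow>\<^sub>M count_space UNIV" and le: "AE \<omega> in M. A \<omega> \<le> n"
  shows "expectation (\<lambda>\<omega>. z ^ A \<omega>) = (\<Sum>k\<le>n. prob {\<omega> \<in> space M. A \<omega> = k} * z ^ k)"
proof -
  have "expectation (\<lambda>\<omega>. z ^ A \<omega>) =
      expectation (\<lambda>\<omega>. \<Sum>k\<le>n. indicator {\<omega> \<in> space M. A \<omega> = k} \<omega> * z ^ k)"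
  proof (rule integral_cong_AE)
    show "AE \<omega> in M. z ^ A \<omega> = (\<Sum>k\<le>n. indicator {\<omega> \<in> space M. A \<omega> = k} \<omega> * z ^ k)"
      using le AE_space
    proof eventually_elim
      case (elim \<omega>)
      then have "(\<Sum>k\<le>n. indicator {\<omega> \<in> space M. A \<omega> = k} \<omega> * z ^ k) =
          (\<Sum>k\<le>n. if k = A \<omega> then z ^ k else 0)"
        by (intro sum.cong) (auto simp: indicator_def)
      with elim show ?case by simp
    qed
  qed measurable
  also have "\<dots> = (\<Sum>k\<le>n. prob {\<omega> \<in> space M. A \<omega> = k} * z ^ k)"
    by (subst Bochner_Integration.integral_sum)
      (auto intro!: integrable_mult_left simp: integrable_indicator_iff emeasure_eq_measure)
  finally show ?thesis .
qed

text \<open>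
  The two generating functions are polynomials of degree at most \<open>n\<close>. As they agree at every real
  point, they have the same coefficients, which are the point probabilities.
\<close>

lemma distr_eqI_pgf:
  fixes A :: "'a \<Rightarrow> nat" and C :: "'b \<Rightarrow> nat"
  assumes M: "prob_space M" and N: "prob_space N"
    and A[measurable]: "A \<in> M \<rightarrow>\<^sub>M count_space UNIV"
    and C[measurable]: "C \<in> N \<rightarrow>\<^sub>M count_space UNIV"
    and A_le: "AE \<omega> in M. A \<omega> \<le> n" and C_le: "AE \<omega> in N. C \<omega> \<le> n"
    and pgf: "\<And>z :: real. (\<integral>\<omega>. z ^ A \<omega> \<partial>M) = (\<integral>\<omega>. z ^ C \<omega> \<partial>N)"
  shows "distr M (count_space UNIV) A = distr N (count_space UNIV) C"
proof -
  interpret M: prob_space M by (rule M)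
  interpret N: prob_space N by (rule N)
  define p where "p = (\<Sum>k\<le>n. monom (M.prob {\<omega> \<in> space M. A \<omega> = k}) k)"
  define q where "q = (\<Sum>k\<le>n. monom (N.prob {\<omega> \<in> space N. C \<omega> = k}) k)"
  have "poly p = poly q"
    using pgf M.pgf_bounded_nat[OF A A_le] N.pgf_bounded_nat[OF C C_le]
    by (auto simp: p_def q_def fun_eq_iff poly_sum poly_monom)
  then have "p = q"
    by (simp add: poly_eq_poly_eq_iff)
  have prob: "M.prob {\<omega> \<in> space M. A \<omega> = k} = N.prob {\<omega> \<in> space N. C \<omega> = k}" for k
  proof (cases "k \<le> n")
    case True
    then show ?thesis
      using arg_cong[OF \<open>p = q\<close>, of "\<lambda>r. coeff r k"]
      by (simp add: p_def q_def coeff_sum)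
  next
    case False
    have "AE \<omega> in M. A \<omega> \<noteq> k" "AE \<omega> in N. C \<omega> \<noteq> k"
      using A_le C_le False by (auto elim: eventually_mono)
    then have "M.prob {\<omega> \<in> space M. A \<omega> = k} = 0" "N.prob {\<omega> \<in> space N. C \<omega> = k} = 0"
      by (auto intro!: M.prob_eq_0[THEN iffD2] N.prob_eq_0[THEN iffD2] elim: eventually_mono)
    then show ?thesis by simp
  qed
  show ?thesis
  proof (rule measure_eqI_countable[where A = UNIV])
    fix k :: nat
    have "A -` {k} \<inter> space M = {\<omega> \<in> space M. A \<omega> = k}"
      "C -` {k} \<inter> space N = {\<omega> \<in> space N. C \<omega> = k}"
      by auto
    then show "emeasure (distr M (count_space UNIV) A) {k} =
        emeasure (distr N (count_space UNIV) C) {k}"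
      using prob[of k]
      by (simp add: emeasure_distr M.emeasure_eq_measure N.emeasure_eq_measure)
  qed auto
qed

lemma expectation_bernoulli_power:
  fixes B :: "'a \<Rightarrow> nat" and z :: real
  assumes B: "bernoulli_distributed N B p" and p: "p \<in> {0..1}"
  shows "(\<integral>\<omega>. z ^ B \<omega> \<partial>N) = 1 + (z - 1) * p"
proof -
  have "(\<integral>\<omega>. z ^ B \<omega> \<partial>N) = (\<integral>k. z ^ k \<partial>distr N (count_space UNIV) B)"
    using B by (subst integral_distr) (auto simp: bernoulli_distributed_def)
  also have "\<dots> = (\<integral>b. z ^ of_bool b \<partial>bernoulli_pmf p)"
    using B by (simp add: bernoulli_distributed_def)
  also have "\<dots> = 1 + (z - 1) * p"
    using p by (simp add: algebra_simps)
  finally show ?thesis .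
qed

text \<open>
  The law of \<open>B\<close> does not see null sets, so other values than \<open>0\<close> and \<open>1\<close> are excluded only
  almost surely. This is why \<open>distr_eqI_pgf\<close> asks for no more than almost sure bounds.
\<close>

lemma bernoulli_distributed_AE_le_1:
  assumes "bernoulli_distributed N B p"
  shows "AE \<omega> in N. B \<omega> \<le> 1"
proof -
  have B: "B \<in> N \<rightarrow>\<^sub>M count_space UNIV"
    and law: "distr N (count_space UNIV) B = measure_pmf (map_pmf of_bool (bernoulli_pmf p))"
    using assms by (auto simp: bernoulli_distributed_def)
  have "AE k in distr N (count_space UNIV) B. k \<le> 1"
    unfolding law by (auto simp: AE_measure_pmf_iff)
  then show ?thesis
    using AE_distr_iff[OF B, of "\<lambda>k. k \<le> 1"] by simp
qed

lemma (in prob_space) expectation_power_sum_bernoulli: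
  fixes B :: "nat \<Rightarrow> 'a \<Rightarrow> nat" and z :: real
  assumes indep: "indep_vars (\<lambda>_. count_space UNIV) B {..<n}"
    and B: "\<And>i. i < n \<Longrightarrow> bernoulli_distributed M (B i) (lam i)"
    and lam: "\<And>i. i < n \<Longrightarrow> lam i \<in> {0..1}"
  shows "expectation (\<lambda>\<omega>. z ^ (\<Sum>i<n. B i \<omega>)) = (\<Prod>i<n. 1 + (z - 1) * lam i)"
proof -
  have "integrable M (\<lambda>\<omega>. z ^ B i \<omega>)" if i: "i < n" for i
  proof (rule integrable_const_bound[where B = "max 1 \<bar>z\<bar>"])
    show "AE \<omega> in M. norm (z ^ B i \<omega>) \<le> max 1 \<bar>z\<bar>"
      using bernoulli_distributed_AE_le_1[OF B[OF i]]
    proof eventually_elim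
      case (elim \<omega>)
      then have "B i \<omega> = 0 \<or> B i \<omega> = 1" by auto
      then show ?case by auto
    qed
    have [measurable]: "B i \<in> M \<rightarrow>\<^sub>M count_space UNIV"
      using B[OF i] by (simp add: bernoulli_distributed_def)
    show "(\<lambda>\<omega>. z ^ B i \<omega>) \<in> borel_measurable M"
      by measurable
  qed
  moreover have "indep_vars (\<lambda>_. borel) (\<lambda>i \<omega>. z ^ B i \<omega>) {..<n}"
    using indep by (rule indep_vars_compose2) simp
  ultimately have "expectation (\<lambda>\<omega>. \<Prod>i<n. z ^ B i \<omega>) = (\<Prod>i<n. expectation (\<lambda>\<omega>. z ^ B i \<omega>))"
    by (intro indep_vars_lebesgue_integral) auto
  also have "\<dots> = (\<Prod>i<n. 1 + (z - 1) * lam i)"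
    using expectation_bernoulli_power[OF B lam] by (intro prod.cong) auto
  finally show ?thesis
    by (simp add: power_sum)
qed

lemma power_one_plus_card_eq_sum_subsets:
  fixes t :: "'a :: comm_semiring_1"
  assumes "finite X"
  shows "(1 + t) ^ card X = (\<Sum>S\<in>Pow X. t ^ card S)"
  using prod_add[OF assms, of "\<lambda>_. t" "\<lambda>_. 1"] by (simp add: add.commute)

text \<open>
  The determinantal law is only known through the events \<open>S \<subseteq> X\<close>. The generating function is taken
  at \<open>1 + t\<close> because there it is a linear combination of the probabilities of exactly these events.
\<close>

lemma (in prob_space) expectation_power_card_dpp:
  fixes t :: real
  assumes dpp: "dpp_distributed M X n K"
  shows "expectation (\<lambda>\<omega>. (1 + t) ^ card (X \<omega>)) =
    (\<Sum>S\<in>Pow {..<n}. t ^ card S * Determinant.det (submatrix K S S))"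
proof -
  let ?U = "{..<n}"
  have X[measurable]: "X \<in> M \<rightarrow>\<^sub>M count_space (Pow ?U)"
    using dpp by (simp add: dpp_distributed_def)
  have meas: "{\<omega> \<in> space M. S \<subseteq> X \<omega>} \<in> events" for S
    using measurable_compose[OF X, of "\<lambda>Y. S \<subseteq> Y" "count_space UNIV"]
    by (auto simp: pred_def)
  have "expectation (\<lambda>\<omega>. (1 + t) ^ card (X \<omega>)) =
      expectation (\<lambda>\<omega>. \<Sum>S\<in>Pow ?U. t ^ card S * indicator {\<omega> \<in> space M. S \<subseteq> X \<omega>} \<omega>)"
  proof (rule Bochner_Integration.integral_cong[OF refl])
    fix \<omega> assume \<omega>: "\<omega> \<in> space M"
    then have sub: "X \<omega> \<subseteq> ?U"
      using measurable_space[OF X] by auto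
    then have "(1 + t) ^ card (X \<omega>) = (\<Sum>S\<in>Pow (X \<omega>). t ^ card S)"
      by (intro power_one_plus_card_eq_sum_subsets) (rule finite_subset, auto)
    also have "\<dots> = (\<Sum>S\<in>Pow ?U. t ^ card S * indicator {\<omega> \<in> space M. S \<subseteq> X \<omega>} \<omega>)"
      using sub \<omega> by (intro sum.mono_neutral_cong_left) (auto simp: indicator_def)
    finally show "(1 + t) ^ card (X \<omega>) =
      (\<Sum>S\<in>Pow ?U. t ^ card S * indicator {\<omega> \<in> space M. S \<subseteq> X \<omega>} \<omega>)" .
  qed
  also have "\<dots> = (\<Sum>S\<in>Pow ?U. t ^ card S * prob {\<omega> \<in> space M. S \<subseteq> X \<omega>})"
    using meas by (subst Bochner_Integration.integral_sum)
      (auto intro!: integrable_mult_right simp: integrable_indicator_iff emeasure_eq_measure)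
  also have "\<dots> = (\<Sum>S\<in>Pow ?U. t ^ card S * Determinant.det (submatrix K S S))"
    using dpp_distributed_inclusion_prob[OF dpp]
    by (intro sum.cong) (auto simp: principal_submatrix_def)
  finally show ?thesis .
qed


section \<open>The number of points\<close>

theorem proposition2p7:
  fixes n :: nat and K :: "real mat" and lam :: "nat \<Rightarrow> real"
    and M :: "'a measure" and X :: "'a \<Rightarrow> nat set"
    and N :: "'b measure" and B :: "nat \<Rightarrow> 'b \<Rightarrow> nat"
  assumes "K \<in> carrier_mat n n"
    and "dpp_kernel n K"
    and "real_eigenvalues_with_mult n K lam"
    and "\<And>i. i < n \<Longrightarrow> lam i \<in> {0..1}"
    and "prob_space M"
    and "dpp_distributed M X n K"
    and "prob_space N"
    and "prob_space.indep_vars N (\<lambda>_. count_space UNIV) B {..<n}"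
    and "\<And>i. i < n \<Longrightarrow> bernoulli_distributed N (B i) (lam i)"
  shows "distr M (count_space UNIV) (\<lambda>\<omega>. card (X \<omega>)) =
         distr N (count_space UNIV) (\<lambda>\<omega>. \<Sum>i<n. B i \<omega>)"
proof (rule distr_eqI_pgf[where n = n])
  interpret M: prob_space M by (rule assms(5))
  interpret N: prob_space N by (rule assms(7))
  have X[measurable]: "X \<in> M \<rightarrow>\<^sub>M count_space (Pow {..<n})"
    using assms(6) by (simp add: dpp_distributed_def)
  have B[measurable]: "B i \<in> N \<rightarrow>\<^sub>M count_space UNIV" if "i < n" for i
    using assms(9)[OF that] by (simp add: bernoulli_distributed_def)
  show "(\<lambda>\<omega>. card (X \<omega>)) \<in> M \<rightarrow>\<^sub>M count_space UNIV"
    by measurable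
  show "(\<lambda>\<omega>. \<Sum>i<n. B i \<omega>) \<in> N \<rightarrow>\<^sub>M count_space UNIV"
    by measurable
  show "AE \<omega> in M. card (X \<omega>) \<le> n"
  proof (rule AE_I2)
    fix \<omega> assume "\<omega> \<in> space M"
    then have "X \<omega> \<subseteq> {..<n}"
      using measurable_space[OF X] by auto
    then show "card (X \<omega>) \<le> n"
      using card_mono[of "{..<n}" "X \<omega>"] by simp
  qed
  have "AE \<omega> in N. \<forall>i\<in>{..<n}. B i \<omega> \<le> 1"
    using bernoulli_distributed_AE_le_1[OF assms(9)] by (intro AE_finite_allI) auto
  then show "AE \<omega> in N. (\<Sum>i<n. B i \<omega>) \<le> n"
  proof eventually_elim
    case (elim \<omega>)
    then show ?case
      using sum_bounded_above[of "{..<n}" "\<lambda>i. B i \<omega>" 1] by simp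
  qed
  fix z :: real
  have "M.expectation (\<lambda>\<omega>. (1 + (z - 1)) ^ card (X \<omega>)) =
      Determinant.det (1\<^sub>m n + (z - 1) \<cdot>\<^sub>m K)"
    by (simp only: M.expectation_power_card_dpp[OF assms(6)]
        det_one_plus_smult_eq_sum_minors[OF assms(1)])
  also have "\<dots> = (\<Prod>i<n. 1 + (z - 1) * lam i)"
    using assms(3) by (intro det_one_plus_smult_eq_prod_eigenvalues[OF assms(1)])
      (simp add: real_eigenvalues_with_mult_def)
  also have "\<dots> = N.expectation (\<lambda>\<omega>. z ^ (\<Sum>i<n. B i \<omega>))"
    by (rule N.expectation_power_sum_bernoulli[symmetric, OF assms(8,9,4)])
  finally show "M.expectation (\<lambda>\<omega>. z ^ card (X \<omega>)) = N.expectation (\<lambda>\<omega>. z ^ (\<Sum>i<n. B i \<omega>))"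
    by simp
qed (fact assms(5) assms(7))+

end
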